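(* Let $k,n\ge 3$ and $0\le\alpha<1$. Let $H$ be a connected $k$-graph on $n$ vertices $v_1,\dots,v_n$, and let $\mathbf{x}=(x_1,\dots,x_n)^T$ be its $\alpha$-Perron vector, normalized so that its maximum entry equals $1$ (write $x_v$ for the entry of vertex $v$). Then for every vertex $v\in V(H)$, $$\rho_\alpha^2(H)\,x_v^{k-1}\le \frac{\alpha}{(k-1)^2}\,w_1^2(v)+\frac{1-\alpha}{(k-1)^2}\,w_2(v).$$
   Context: A $k$-graph ($k$-uniform hypergraph) $H$ consists of a finite vertex set $V(H)$ and a set $E(H)$ of $k$-element subsets of $V(H)$ (edges). Two vertices are adjacent if some edge contains both; $H$ is connected if the graph on $V(H)$ with this adjacency relation is connected. The degree $d_v$ of a vertex $v$ is the number of edges containing $v$. For $V(H)=\{v_1,\dots,v_n\}$, the adjacency tensor $\mathcal{A}(H)=(a_{i_1\dots i_k})$ is the order-$k$, dimension-$n$ tensor with $a_{i_1\dots i_k}=\frac{1}{(k-1)!}$ if $\{v_{i_1},\dots,v_{i_k}\}\in E(H)$ and $0$ otherwise; $\mathcal{D}(H)$ is the diagonal tensor with entries $d_{i\dots i}=d_{v_i}$ and all other entries $0$. For $0\le\alpha<1$, $\mathcal{A}_\alpha(H)=\alpha\mathcal{D}(H)+(1-\alpha)\mathcal{A}(H)$. A number $\lambda\in\mathbb{C}$ is an eigenvalue of an order-$k$ dimension-$n$ tensor $\mathcal{A}=(a_{i_1\dots i_k})$ if there is a nonzero $\mathbf{x}\in\mathbb{C}^n$ with $\sum_{i_2,\dots,i_k=1}^n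 a_{i i_2\dots i_k}x_{i_2}\cdots x_{i_k}=\lambda x_i^{k-1}$ for all $i\in[n]$; the spectral radius is the largest modulus of an eigenvalue. $\rho_\alpha(H)$ denotes the spectral radius of $\mathcal{A}_\alpha(H)$. For connected $H$, $\rho_\alpha(H)$ is an eigenvalue of $\mathcal{A}_\alpha(H)$ with an eigenvector having all entries positive, unique up to positive scaling; this vector is the $\alpha$-Perron vector of $H$. A Berge walk of length $h$ is a sequence $u_1e_1u_2e_2\cdots u_he_hu_{h+1}$ of vertices and edges with $u_i\ne u_{i+1}$ and $\{u_i,u_{i+1}\}\subseteq e_i$ for all $i$; $w_h(v)$ is the number of Berge walks of length $h$ starting at $v$. (Thus $w_1(v)=(k-1)d_v$ and $w_{h+1}(v)=\sum_{\{v,u_2,\dots,u_k\}\in E(H)}(w_h(u_2)+\cdots+w_h(u_k))$.) *)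

theory Defs
  imports Complex_Main
begin

section \<open>Uniform hypergraphs\<close>

definition k_graph :: "nat \<Rightarrow> 'v set \<Rightarrow> 'v set set \<Rightarrow> bool" where
  "k_graph k V E \<longleftrightarrow> finite V \<and> (\<forall>e\<in>E. e \<subseteq> V \<and> card e = k)"

definition adjacent :: "'v set set \<Rightarrow> 'v \<Rightarrow> 'v \<Rightarrow> bool" where
  "adjacent E u v \<longleftrightarrow> u \<noteq> v \<and> (\<exists>e\<in>E. u \<in> e \<and> v \<in> e)"

definition connected_hypergraph :: "'v set \<Rightarrow> 'v set set \<Rightarrow> bool" where
  "connected_hypergraph V E \<longleftrightarrow> (\<forall>u\<in>V. \<forall>v\<in>V. (adjacent E)\<^sup>*\<^sup>* u v)"

definition degree :: "'v set set \<Rightarrow> 'v \<Rightarrow> nat" where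
  "degree E v = card {e \<in> E. v \<in> e}"

text \<open>
  A walk \<open>u\<^sub>1 e\<^sub>1 u\<^sub>2 \<dots> u\<^sub>h e\<^sub>h u\<^sub>h\<^sub>+\<^sub>1\<close> is the pair of its vertex list (length \<open>h + 1\<close>) and its
  edge list (length \<open>h\<close>).
\<close>

definition berge_walk :: "'v set \<Rightarrow> 'v set set \<Rightarrow> nat \<Rightarrow> 'v list \<Rightarrow> 'v set list \<Rightarrow> bool" where
  "berge_walk V E h us es \<longleftrightarrow>
     length us = Suc h \<and> length es = h \<and> set us \<subseteq> V \<and> set es \<subseteq> E \<and>
     (\<forall>i<h. us ! i \<noteq> us ! Suc i \<and> {us ! i, us ! Suc i} \<subseteq> es ! i)"

definition num_walks :: "'v set \<Rightarrow> 'v set set \<Rightarrow> nat \<Rightarrow> 'v \<Rightarrow> nat" where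
  "num_walks V E h v = card {(us, es). berge_walk V E h us es \<and> us ! 0 = v}"


section \<open>Tensors and their eigenvalues\<close>

text \<open>
  A tensor of order \<open>k\<close> and dimension \<open>n\<close> is a function on index lists; only lists of length
  \<open>k\<close> over an index set \<open>I\<close> of cardinality \<open>n\<close> matter. Likewise a vector is a function of
  which only the values on \<open>I\<close> matter.
\<close>

definition tensor_apply ::
    "'i set \<Rightarrow> nat \<Rightarrow> ('i list \<Rightarrow> complex) \<Rightarrow> ('i \<Rightarrow> complex) \<Rightarrow> 'i \<Rightarrow> complex" where
  "tensor_apply I k A x i =
     (\<Sum>js\<in>{js. length js = k - 1 \<and> set js \<subseteq> I}. A (i # js) * prod_list (map x js))"

definition tensor_eigenpair ::
    "'i set \<Rightarrow> nat \<Rightarrow> ('i list \<Rightarrow> complex) \<Rightarrow> complex \<Rightarrow> ('i \<Rightarrow> complex) \<Rightarrow> bool" where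
  "tensor_eigenpair I k A l x \<longleftrightarrow>
     (\<exists>i\<in>I. x i \<noteq> 0) \<and> (\<forall>i\<in>I. tensor_apply I k A x i = l * x i ^ (k - 1))"

definition tensor_eigenvalue :: "'i set \<Rightarrow> nat \<Rightarrow> ('i list \<Rightarrow> complex) \<Rightarrow> complex \<Rightarrow> bool" where
  "tensor_eigenvalue I k A l \<longleftrightarrow> (\<exists>x. tensor_eigenpair I k A l x)"

definition tensor_spectral_radius :: "'i set \<Rightarrow> nat \<Rightarrow> ('i list \<Rightarrow> complex) \<Rightarrow> real" where
  "tensor_spectral_radius I k A = (GREATEST r. \<exists>l. tensor_eigenvalue I k A l \<and> r = cmod l)"


section \<open>Tensors of a hypergraph\<close>

text \<open>
  The tensors are indexed by the vertices themselves rather than by their positions in an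
  enumeration \<open>v\<^sub>1, \<dots>, v\<^sub>n\<close>.
\<close>

definition adjacency_tensor :: "nat \<Rightarrow> 'v set set \<Rightarrow> 'v list \<Rightarrow> complex" where
  "adjacency_tensor k E vs = (if set vs \<in> E then 1 / fact (k - 1) else 0)"

definition degree_tensor :: "nat \<Rightarrow> 'v set set \<Rightarrow> 'v list \<Rightarrow> complex" where
  "degree_tensor k E vs = (if vs = replicate k (hd vs) then of_nat (degree E (hd vs)) else 0)"

definition alpha_tensor :: "real \<Rightarrow> nat \<Rightarrow> 'v set set \<Rightarrow> 'v list \<Rightarrow> complex" where
  "alpha_tensor \<alpha> k E vs =
     of_real \<alpha> * degree_tensor k E vs + of_real (1 - \<alpha>) * adjacency_tensor k E vs"

definition alpha_spectral_radius :: "real \<Rightarrow> nat \<Rightarrow> 'v set \<Rightarrow> 'v set set \<Rightarrow> real" where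
  "alpha_spectral_radius \<alpha> k V E = tensor_spectral_radius V k (alpha_tensor \<alpha> k E)"

text \<open>For a connected hypergraph such a vector exists and is unique on \<open>V\<close> up to positive scaling.\<close>

definition alpha_perron_vector :: "real \<Rightarrow> nat \<Rightarrow> 'v set \<Rightarrow> 'v set set \<Rightarrow> ('v \<Rightarrow> real) \<Rightarrow> bool" where
  "alpha_perron_vector \<alpha> k V E x \<longleftrightarrow>
     (\<forall>v\<in>V. x v > 0) \<and>
     tensor_eigenpair V k (alpha_tensor \<alpha> k E)
       (of_real (alpha_spectral_radius \<alpha> k V E)) (\<lambda>v. of_real (x v))"

end

theory Submission
  imports Defs "HOL-Analysis.Convex" "HOL-Combinatorics.Multiset_Permutations"
begin

text \<open>
  Writing \<open>\<rho>\<close> for the spectral radius, the eigenvalue equation of the Perron vector reads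
  \<open>\<rho> x\<^sub>v\<^sup>k\<^sup>-\<^sup>1 = \<alpha> d\<^sub>v x\<^sub>v\<^sup>k\<^sup>-\<^sup>1 + (1 - \<alpha>) \<Sum>\<^sub>e \<Prod>\<^sub>u x\<^sub>u\<close>, where \<open>e\<close> ranges over the edges through
  \<open>v\<close> and \<open>u\<close> over \<open>e - {v}\<close>. As all entries are at most 1, it gives \<open>\<rho> x\<^sub>v\<^sup>k\<^sup>-\<^sup>1 \<le> d\<^sub>v\<close>. Multiply
  the equation by \<open>\<rho>\<close>, replace each product by the mean of the \<open>x\<^sub>u\<^sup>k\<^sup>-\<^sup>1\<close> (AM-GM), and apply
  this bound to every term.
\<close>

text \<open>AM-GM for the numbers \<open>y u ^ m\<close>: since \<open>S\<close> has exactly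
  \<open>m\<close> elements, their geometric mean is the plain product of the
  \<open>y u\<close>.\<close>

lemma prod_le_mean_power:
  fixes y :: "'a \<Rightarrow> real"
  assumes "finite S" "card S = m" "m > 0" and nonneg: "\<And>u. u \<in> S \<Longrightarrow> y u \<ge> 0"
  shows "(\<Prod>u\<in>S. y u) \<le> (\<Sum>u\<in>S. y u ^ m) / real m"
proof -
  have "S \<noteq> {}" using assms by auto
  have "(\<Prod>u\<in>S. y u) = root m ((\<Prod>u\<in>S. y u) ^ m)"
    using assms by (simp add: real_root_power_cancel prod_nonneg)
  also have "\<dots> = (\<Prod>u\<in>S. y u ^ m) powr (1 / m)"
    using assms by (subst root_powr_inverse) (auto simp: prod_power_distrib intro!: prod_nonneg)
  also have "\<dots> \<le> (\<Sum>u\<in>S. y u ^ m / m)"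
    using arith_geom_mean[OF \<open>finite S\<close> \<open>S \<noteq> {}\<close>, of "\<lambda>u. y u ^ m"] nonneg
    unfolding \<open>card S = m\<close> by simp
  also have "\<dots> = (\<Sum>u\<in>S. y u ^ m) / real m"
    by (simp add: sum_divide_distrib)
  finally show ?thesis .
qed

lemma k_graph_finite_edges: "k_graph k V E \<Longrightarrow> finite E"
  unfolding k_graph_def by (meson PowI finite_Pow_iff finite_subset subsetI)

lemma k_graph_edge:
  assumes "k_graph k V E" "e \<in> E"
  shows "e \<subseteq> V" "finite e" "card e = k"
  using assms unfolding k_graph_def by (auto intro: finite_subset)

lemma num_walks_0: "v \<in> V \<Longrightarrow> num_walks V E 0 v = 1"
proof -
  assume "v \<in> V"
  then have "{(us, es). berge_walk V E 0 us es \<and> us ! 0 = v} = {([v], [])}"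
    by (auto simp: berge_walk_def length_Suc_conv)
  then show ?thesis by (simp add: num_walks_def)
qed

lemma berge_walk_Cons:
  "berge_walk V E (Suc h) (v # us) (e # es) \<longleftrightarrow>
     v \<in> V \<and> e \<in> E \<and> v \<in> e \<and> us ! 0 \<in> e - {v} \<and> berge_walk V E h us es"
  unfolding berge_walk_def by (auto simp: All_less_Suc2)

text \<open>Counting by disjoint unions needs this, as \<open>card\<close> is 0 on infinite
  sets.\<close>

lemma finite_berge_walks:
  assumes "k_graph k V E"
  shows "finite {(us, es). berge_walk V E h us es \<and> us ! 0 = v}"
proof (rule finite_subset)
  show "{(us, es). berge_walk V E h us es \<and> us ! 0 = v} \<subseteq>
      {us. set us \<subseteq> V \<and> length us = Suc h} \<times> {es. set es \<subseteq> E \<and> length es = h}"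
    by (auto simp: berge_walk_def)
  show "finite ({us. set us \<subseteq> V \<and> length us = Suc h} \<times> {es. set es \<subseteq> E \<and> length es = h})"
    using assms k_graph_finite_edges[OF assms]
    by (intro finite_cartesian_product finite_lists_length_eq) (auto simp: k_graph_def)
qed

text \<open>Sort the walks by their first edge \<open>e\<close> and second vertex \<open>u\<close>;
  deleting the first step is a bijection from each class onto the walks of length \<open>h\<close>
  from \<open>u\<close>.\<close>

lemma num_walks_Suc:
  assumes "k_graph k V E" "v \<in> V"
  shows "num_walks V E (Suc h) v = (\<Sum>e | e \<in> E \<and> v \<in> e. \<Sum>u\<in>e - {v}. num_walks V E h u)"
proof -
  define W where "W h u = {(us, es). berge_walk V E h us es \<and> us ! 0 = u}" for h u
  define D where "D = (SIGMA e:{e \<in> E. v \<in> e}. e - {v})"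
  define ext where "ext e = (\<lambda>(us, es). (v # us, e # es))" for e :: "'a set"
  have inj: "inj_on (ext e) A" for e A
    by (auto simp: inj_on_def ext_def)
  have fin: "finite (W h u)" for h u
    unfolding W_def by (rule finite_berge_walks[OF assms(1)])
  have finD: "finite D"
    unfolding D_def using k_graph_finite_edges[OF assms(1)] k_graph_edge[OF assms(1)] by auto
  have "W (Suc h) v = (\<Union>(e, u)\<in>D. ext e ` W h u)"
  proof (intro set_eqI iffI)
    fix w assume "w \<in> W (Suc h) v"
    then obtain us e es where "w = (v # us, e # es)" and b: "berge_walk V E (Suc h) (v # us) (e # es)"
      by (auto simp: W_def berge_walk_def length_Suc_conv)
    then have "(e, us ! 0) \<in> D" "w \<in> ext e ` W h (us ! 0)"
      by (auto simp: berge_walk_Cons D_def W_def ext_def)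
    then show "w \<in> (\<Union>(e, u)\<in>D. ext e ` W h u)" by blast
  next
    fix w assume "w \<in> (\<Union>(e, u)\<in>D. ext e ` W h u)"
    then show "w \<in> W (Suc h) v"
      using assms(2) by (auto simp: W_def D_def ext_def berge_walk_Cons)
  qed
  also have "card \<dots> = (\<Sum>(e, u)\<in>D. card (ext e ` W h u))"
    \<comment> \<open>The images are disjoint because \<open>e\<close> and \<open>u\<close> can be
      read off an extended walk, as its first edge and second vertex.\<close>
    using finD fin by (subst card_UN_disjoint) (auto simp: ext_def W_def case_prod_unfold)
  also have "\<dots> = (\<Sum>(e, u)\<in>D. card (W h u))"
    by (simp add: card_image[OF inj])
  also have "\<dots> = (\<Sum>e | e \<in> E \<and> v \<in> e. \<Sum>u\<in>e - {v}. card (W h u))"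
    unfolding D_def using k_graph_finite_edges[OF assms(1)] k_graph_edge[OF assms(1)]
    by (subst sum.Sigma) auto
  finally show ?thesis by (simp add: W_def num_walks_def)
qed

lemma num_walks_1:
  assumes "k_graph k V E" "v \<in> V"
  shows "num_walks V E 1 v = (k - 1) * degree E v"
proof -
  have "num_walks V E 1 v = (\<Sum>e | e \<in> E \<and> v \<in> e. \<Sum>u\<in>e - {v}. num_walks V E 0 u)"
    using num_walks_Suc[OF assms, of 0] by simp
  also have "\<dots> = (\<Sum>e | e \<in> E \<and> v \<in> e. \<Sum>u\<in>e - {v}. 1)"
    using k_graph_edge(1)[OF assms(1)] by (intro sum.cong refl num_walks_0) auto
  also have "\<dots> = (\<Sum>e | e \<in> E \<and> v \<in> e. k - 1)"
    using k_graph_edge[OF assms(1)] by (intro sum.cong) auto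
  finally show ?thesis by (simp add: degree_def)
qed

lemma num_walks_2:
  assumes "k_graph k V E" "v \<in> V"
  shows "num_walks V E 2 v = (k - 1) * (\<Sum>e | e \<in> E \<and> v \<in> e. \<Sum>u\<in>e - {v}. degree E u)"
proof -
  have "num_walks V E 2 v = (\<Sum>e | e \<in> E \<and> v \<in> e. \<Sum>u\<in>e - {v}. num_walks V E 1 u)"
    using num_walks_Suc[OF assms, of 1] by (simp add: numeral_2_eq_2)
  also have "\<dots> = (\<Sum>e | e \<in> E \<and> v \<in> e. \<Sum>u\<in>e - {v}. (k - 1) * degree E u)"
    using k_graph_edge(1)[OF assms(1)] num_walks_1[OF assms(1)] by (intro sum.cong) auto
  finally show ?thesis by (simp add: sum_distrib_left)
qed

lemma tensor_apply_degree_tensor: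
  assumes "finite V" "v \<in> V" "k > 0"
  shows "tensor_apply V k (degree_tensor k E) x v = of_nat (degree E v) * x v ^ (k - 1)"
proof -
  let ?J = "{js. length js = k - 1 \<and> set js \<subseteq> V}"
  have fin: "finite ?J"
    using finite_lists_length_eq[OF assms(1), of "k - 1"] by (simp add: conj_commute)
  \<comment> \<open>Only the constant list meets the diagonal. For \<open>k = 0\<close> the right
    side could hold while the left could not.\<close>
  have rep: "v # js = replicate k v \<longleftrightarrow> js = replicate (k - 1) v" for js
    using assms(3) by (cases k) auto
  have "tensor_apply V k (degree_tensor k E) x v =
      (\<Sum>js\<in>?J. if js = replicate (k - 1) v then of_nat (degree E v) * x v ^ (k - 1) else 0)"
    unfolding tensor_apply_def
    by (intro sum.cong) (auto simp: degree_tensor_def rep simp del: replicate_Suc)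
  also have "\<dots> = of_nat (degree E v) * x v ^ (k - 1)"
    using fin assms(2) by (subst sum.delta) auto
  finally show ?thesis .
qed

text \<open>A list \<open>v # js\<close> of length \<open>k\<close> whose set is an edge has no
  repetition, so \<open>js\<close> is an ordering of \<open>e - {v}\<close>. Each edge has (k-1)!
  such orderings, all with the same product, which cancels the weight 1/(k-1)!.\<close>

lemma tensor_apply_adjacency_tensor:
  assumes "k_graph k V E" "v \<in> V" "k > 0"
  shows "tensor_apply V k (adjacency_tensor k E) x v =
    (\<Sum>e | e \<in> E \<and> v \<in> e. \<Prod>u\<in>e - {v}. x u)"
proof -
  let ?J = "{js. length js = k - 1 \<and> set js \<subseteq> V}"
  let ?N = "{e \<in> E. v \<in> e}"
  have "finite V" using assms(1) by (simp add: k_graph_def)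
  then have fin: "finite ?J"
    using finite_lists_length_eq[of V "k - 1"] by (simp add: conj_commute)
  have finN: "finite ?N" using k_graph_finite_edges[OF assms(1)] by simp
  have support: "{js \<in> ?J. set (v # js) \<in> E} = (\<Union>e\<in>?N. permutations_of_set (e - {v}))"
  proof (intro set_eqI iffI)
    fix js assume js: "js \<in> {js \<in> ?J. set (v # js) \<in> E}"
    then have "card (set (v # js)) = length (v # js)"
      using k_graph_edge(3)[OF assms(1)] assms(3) by auto
    then have "distinct (v # js)" by (rule card_distinct)
    with js have "set (v # js) \<in> ?N" "js \<in> permutations_of_set (set (v # js) - {v})"
      by (auto simp: permutations_of_set_def)
    then show "js \<in> (\<Union>e\<in>?N. permutations_of_set (e - {v}))" by blast
  next
    fix js assume "js \<in> (\<Union>e\<in>?N. permutations_of_set (e - {v}))"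
    then obtain e where e: "e \<in> E" "v \<in> e" "set js = e - {v}" "distinct js"
      by (auto simp: permutations_of_set_def)
    then have "length js = k - 1"
      using k_graph_edge[OF assms(1) e(1)] distinct_card[OF e(4)] by simp
    moreover have "set (v # js) = e" using e by auto
    ultimately show "js \<in> {js \<in> ?J. set (v # js) \<in> E}"
      using e k_graph_edge(1)[OF assms(1) e(1)] by auto
  qed
  have "tensor_apply V k (adjacency_tensor k E) x v =
      (\<Sum>js | js \<in> ?J \<and> set (v # js) \<in> E. prod_list (map x js) / fact (k - 1))"
    unfolding tensor_apply_def
    by (subst sum.inter_filter[OF fin]) (intro sum.cong, auto simp: adjacency_tensor_def)
  also have "\<dots> = (\<Sum>e\<in>?N. \<Sum>js\<in>permutations_of_set (e - {v}). prod_list (map x js) / fact (k - 1))"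
    unfolding support
  proof (rule sum.UNION_disjoint[OF finN])
    \<comment> \<open>Both edges contain \<open>v\<close>, so each is recovered from an ordering of
      its other vertices.\<close>
    show "\<forall>e\<in>?N. \<forall>e'\<in>?N. e \<noteq> e' \<longrightarrow>
        permutations_of_set (e - {v}) \<inter> permutations_of_set (e' - {v}) = {}"
      by (auto simp: permutations_of_set_def)
  qed simp
  also have "\<dots> = (\<Sum>e\<in>?N. \<Sum>js\<in>permutations_of_set (e - {v}). (\<Prod>u\<in>e - {v}. x u) / fact (k - 1))"
    by (intro sum.cong refl) (metis permutations_of_setD prod.distinct_set_conv_list)
  also have "\<dots> = (\<Sum>e\<in>?N. \<Prod>u\<in>e - {v}. x u)"
    using k_graph_edge[OF assms(1)] by (intro sum.cong) auto
  finally show ?thesis .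
qed

text \<open>The eigenvalue equation is linear in the tensor, so the two previous lemmas evaluate it.
  All quantities are real, and injectivity of \<open>of_real\<close> removes the complex
  embedding.\<close>

lemma alpha_perron_vector_eq:
  assumes "k_graph k V E" "k > 0" "alpha_perron_vector \<alpha> k V E x" "v \<in> V"
  shows "alpha_spectral_radius \<alpha> k V E * x v ^ (k - 1) =
    \<alpha> * degree E v * x v ^ (k - 1) + (1 - \<alpha>) * (\<Sum>e | e \<in> E \<and> v \<in> e. \<Prod>u\<in>e - {v}. x u)"
proof -
  let ?x = "\<lambda>v. complex_of_real (x v)"
  have "finite V" using assms(1) by (simp add: k_graph_def)
  have "complex_of_real (alpha_spectral_radius \<alpha> k V E * x v ^ (k - 1)) =
      tensor_apply V k (alpha_tensor \<alpha> k E) ?x v"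
    using assms(3,4) by (simp add: alpha_perron_vector_def tensor_eigenpair_def)
  also have "\<dots> = of_real \<alpha> * tensor_apply V k (degree_tensor k E) ?x v +
      of_real (1 - \<alpha>) * tensor_apply V k (adjacency_tensor k E) ?x v"
    by (simp only: tensor_apply_def alpha_tensor_def distrib_right sum.distrib
        sum_distrib_left mult.assoc)
  also have "\<dots> = complex_of_real (\<alpha> * degree E v * x v ^ (k - 1) +
      (1 - \<alpha>) * (\<Sum>e | e \<in> E \<and> v \<in> e. \<Prod>u\<in>e - {v}. x u))"
    using tensor_apply_degree_tensor[OF \<open>finite V\<close> assms(4,2)]
      tensor_apply_adjacency_tensor[OF assms(1,4,2)] by simp
  finally show ?thesis by (simp only: of_real_eq_iff)
qed

theorem theorem2p1:
  fixes k n :: nat and \<alpha> :: real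
    and V :: "'v set" and E :: "'v set set" and x :: "'v \<Rightarrow> real"
  assumes "k \<ge> 3" and "n \<ge> 3"
    and "0 \<le> \<alpha>" and "\<alpha> < 1"
    and "k_graph k V E" and "card V = n" and "connected_hypergraph V E"
    and "alpha_perron_vector \<alpha> k V E x" and "Max (x ` V) = 1"
  shows "\<forall>v\<in>V. (alpha_spectral_radius \<alpha> k V E)\<^sup>2 * x v ^ (k - 1)
           \<le> \<alpha> / (real k - 1)\<^sup>2 * (real (num_walks V E 1 v))\<^sup>2
             + (1 - \<alpha>) / (real k - 1)\<^sup>2 * real (num_walks V E 2 v)"
proof
  fix v assume v: "v \<in> V"
  define \<rho> where "\<rho> = alpha_spectral_radius \<alpha> k V E"
  define P where "P v = (\<Sum>e | e \<in> E \<and> v \<in> e. \<Prod>u\<in>e - {v}. x u)" for v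
  define S where "S = (\<Sum>e | e \<in> E \<and> v \<in> e. \<Sum>u\<in>e - {v}. real (degree E u))"
  have km: "real (k - 1) = real k - 1" and k0: "k > 0" and km0: "real k - 1 > 0"
    using assms(1) by auto
  have "finite V" using assms(5) by (simp add: k_graph_def)
  have pos: "x u > 0" if "u \<in> V" for u
    using assms(8) that by (simp add: alpha_perron_vector_def)
  have le1: "x u \<le> 1" if "u \<in> V" for u
    using Max_ge[of "x ` V" "x u"] \<open>finite V\<close> that assms(9) by simp
  note edge = k_graph_edge[OF assms(5)]
  have eq: "\<rho> * x u ^ (k - 1) = \<alpha> * degree E u * x u ^ (k - 1) + (1 - \<alpha>) * P u"
    if "u \<in> V" for u
    using alpha_perron_vector_eq[OF assms(5) k0 assms(8) that] by (simp add: \<rho>_def P_def)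
  \<comment> \<open>The right side of \<open>eq\<close> weights
    \<open>degree E u * x u ^ (k - 1)\<close> by \<alpha> and \<open>P u\<close> by 1 - \<alpha>;
    each is at most the degree.\<close>
  have bound: "\<rho> * x u ^ (k - 1) \<le> degree E u" if u: "u \<in> V" for u
  proof -
    have "P u \<le> (\<Sum>e | e \<in> E \<and> u \<in> e. 1)"
      unfolding P_def
      using edge(1) by (intro sum_mono prod_le_1) (auto intro!: less_imp_le[OF pos] le1)
    then have "P u \<le> degree E u" by (simp add: degree_def)
    then have "(1 - \<alpha>) * P u \<le> (1 - \<alpha>) * degree E u"
      using assms(4) by (intro mult_left_mono) auto
    moreover have "\<alpha> * degree E u * x u ^ (k - 1) \<le> \<alpha> * degree E u"
      using assms(3) power_le_one[of "x u" "k - 1"] pos[OF u] le1[OF u]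
      by (intro mult_right_le_one_le) auto
    ultimately show ?thesis using eq[OF u] by (simp add: algebra_simps)
  qed
  \<comment> \<open>The \<open>GREATEST\<close> in the definition yields no sign unless a greatest
    modulus is known to exist. The sign is read off \<open>eq\<close> instead, whose right side is
    nonnegative while \<open>x v\<close> is positive.\<close>
  have rho: "\<rho> \<ge> 0"
  proof -
    have "P v \<ge> 0"
      unfolding P_def using edge(1) by (intro sum_nonneg prod_nonneg) (auto intro!: less_imp_le[OF pos])
    then have "\<rho> * x v ^ (k - 1) \<ge> 0"
      using eq[OF v] assms(3,4) pos[OF v] by simp
    then show ?thesis
      using zero_less_power[OF pos[OF v], of "k - 1"] by (metis zero_le_mult_iff not_le)
  qed
  have edge_bound: "\<rho> * (\<Prod>u\<in>e - {v}. x u) \<le> (\<Sum>u\<in>e - {v}. real (degree E u)) / (real k - 1)"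
    if e: "e \<in> E" "v \<in> e" for e
  proof -
    \<comment> \<open>AM-GM over the k - 1 vertices of \<open>e - {v}\<close> produces exactly the
      powers that \<open>bound\<close> controls.\<close>
    have "(\<Prod>u\<in>e - {v}. x u) \<le> (\<Sum>u\<in>e - {v}. x u ^ (k - 1)) / real (k - 1)"
      using edge[OF e(1)] e(2) assms(1)
      by (intro prod_le_mean_power) (auto intro!: less_imp_le[OF pos])
    then have "\<rho> * (\<Prod>u\<in>e - {v}. x u) \<le> \<rho> * ((\<Sum>u\<in>e - {v}. x u ^ (k - 1)) / real (k - 1))"
      using rho by (rule mult_left_mono)
    also have "\<dots> = (\<Sum>u\<in>e - {v}. \<rho> * x u ^ (k - 1)) / (real k - 1)"
      by (simp add: sum_distrib_left km del: One_nat_def)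
    also have "\<dots> \<le> (\<Sum>u\<in>e - {v}. real (degree E u)) / (real k - 1)"
      using edge(1)[OF e(1)] km0 by (intro divide_right_mono sum_mono bound) auto
    finally show ?thesis .
  qed
  have "\<rho> * P v \<le> S / (real k - 1)"
    \<comment> \<open>Fixing the index set moves the division into the outer sum only, which leaves
      the summands in the form of \<open>edge_bound\<close>.\<close>
    unfolding P_def S_def sum_distrib_left sum_divide_distrib[of _ "{e \<in> E. v \<in> e}"]
    by (intro sum_mono edge_bound) auto
  then have "(1 - \<alpha>) * (\<rho> * P v) \<le> (1 - \<alpha>) * (S / (real k - 1))"
    using assms(4) by (intro mult_left_mono) auto
  moreover have "\<alpha> * degree E v * (\<rho> * x v ^ (k - 1)) \<le> \<alpha> * degree E v * degree E v"
    using assms(3) by (intro mult_left_mono bound[OF v]) auto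
  \<comment> \<open>This is \<open>eq\<close> times \<rho>, with one factor \<rho> kept beside each
    quantity already bounded.\<close>
  moreover have "\<rho>\<^sup>2 * x v ^ (k - 1) = \<alpha> * degree E v * (\<rho> * x v ^ (k - 1)) + (1 - \<alpha>) * (\<rho> * P v)"
    using arg_cong[OF eq[OF v], of "(*) \<rho>"] by (simp add: power2_eq_square algebra_simps)
  ultimately have "\<rho>\<^sup>2 * x v ^ (k - 1) \<le> \<alpha> * (degree E v)\<^sup>2 + (1 - \<alpha>) * (S / (real k - 1))"
    by (simp add: power2_eq_square algebra_simps)
  also have "\<alpha> * (degree E v)\<^sup>2 = \<alpha> / (real k - 1)\<^sup>2 * (real (num_walks V E 1 v))\<^sup>2"
    using km0 num_walks_1[OF assms(5) v] by (simp add: km power_mult_distrib del: One_nat_def)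
  \<comment> \<open>One factor 1/(k-1) is the AM-GM mean; the other offsets the factor k - 1 in
    \<open>num_walks_2\<close>.\<close>
  also have "(1 - \<alpha>) * (S / (real k - 1)) = (1 - \<alpha>) / (real k - 1)\<^sup>2 * real (num_walks V E 2 v)"
    using km0 num_walks_2[OF assms(5) v] by (simp add: km S_def power2_eq_square del: One_nat_def)
  finally show "(alpha_spectral_radius \<alpha> k V E)\<^sup>2 * x v ^ (k - 1)
           \<le> \<alpha> / (real k - 1)\<^sup>2 * (real (num_walks V E 1 v))\<^sup>2
             + (1 - \<alpha>) / (real k - 1)\<^sup>2 * real (num_walks V E 2 v)"
    unfolding \<rho>_def .
qed

end
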